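(* Let $n\in\mathbb N$ and let $u,e\in (M_n)_s$ be two unitary elements. Then $u\sim_{h,t}e$ in $(M_n)_s$ if and only if $\det u=\pm\det e$. Moreover, in this case there is a chain of $\sim_h$ in $(M_n)_s$ from $u$ to $e$ of length at most $2n-1$ (of length at most $2n-2$ in case $\det u=\det e$).
   Context: $(M_n)_s$ is the space of symmetric complex $n\times n$ matrices ($x^t=x$) with triple product $\{a,b,c\}=\frac12(ab^*c+cb^*a)$. A tripotent is an element $e\in(M_n)_s$ with $\{e,e,e\}=e$; the unitary elements of $(M_n)_s$ are exactly the symmetric matrices which are unitary. For tripotents $u,e\in(M_n)_s$: $u\le_h e$ iff $u=\{e,u,e\}$; $u\sim_h e$ iff $u\le_he$ and $e\le_hu$; $u\le_{h,t}e$ iff there are tripotents $e=v_0,\dots,v_k=u$ in $(M_n)_s$ with $v_j\le_hv_{j-1}$ for all $j$; $u\sim_{h,t}e$ iff $u\le_{h,t}e$ and $e\le_{h,t}u$. A chain of $\sim_h$ of length $k$ from $u$ to $e$ consists of tripotents $u=w_0\sim_hw_1\sim_h\dots\sim_hw_k=e$ in $(M_n)_s$. *)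

theory Defs
  imports "HOL-Analysis.Analysis"
begin

definition adjoint_mat :: "complex^'n^'m \<Rightarrow> complex^'m^'n" where
  "adjoint_mat a = (\<chi> i j. cnj (a $ j $ i))"

definition sym_mats :: "(complex^'n^'n) set" where
  "sym_mats = {x. transpose x = x}"

definition unitary_mat :: "complex^'n^'n \<Rightarrow> bool" where
  "unitary_mat a \<longleftrightarrow> adjoint_mat a ** a = mat 1 \<and> a ** adjoint_mat a = mat 1"

definition triple :: "complex^'n^'n \<Rightarrow> complex^'n^'n \<Rightarrow> complex^'n^'n \<Rightarrow> complex^'n^'n" where
  "triple a b c = (1/2) *\<^sub>R (a ** adjoint_mat b ** c + c ** adjoint_mat b ** a)"

definition sym_tripotent :: "complex^'n^'n \<Rightarrow> bool" where
  "sym_tripotent e \<longleftrightarrow> e \<in> sym_mats \<and> triple e e e = e"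

text \<open>The relations \<open>le_h\<close> and \<open>sim_h\<close> are meaningful for tripotents only; every use
  below restricts them to elements satisfying \<^const>\<open>sym_tripotent\<close>.\<close>

definition le_h :: "complex^'n^'n \<Rightarrow> complex^'n^'n \<Rightarrow> bool" where
  "le_h u e \<longleftrightarrow> u = triple e u e"

definition sim_h :: "complex^'n^'n \<Rightarrow> complex^'n^'n \<Rightarrow> bool" where
  "sim_h u e \<longleftrightarrow> le_h u e \<and> le_h e u"

definition le_ht :: "complex^'n^'n \<Rightarrow> complex^'n^'n \<Rightarrow> bool" where
  "le_ht u e \<longleftrightarrow> (\<exists>(k::nat) v. v 0 = e \<and> v k = u \<and>
     (\<forall>j\<le>k. sym_tripotent (v j)) \<and> (\<forall>j\<in>{1..k}. le_h (v j) (v (j - 1))))"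

definition sim_ht :: "complex^'n^'n \<Rightarrow> complex^'n^'n \<Rightarrow> bool" where
  "sim_ht u e \<longleftrightarrow> le_ht u e \<and> le_ht e u"

definition sim_h_chain :: "nat \<Rightarrow> complex^'n^'n \<Rightarrow> complex^'n^'n \<Rightarrow> bool" where
  "sim_h_chain k u e \<longleftrightarrow> (\<exists>w. w 0 = u \<and> w k = e \<and>
     (\<forall>j\<le>k. sym_tripotent (w j)) \<and> (\<forall>j<k. sim_h (w j) (w (Suc j))))"

end

theory Submission
  imports Defs
begin

text \<open>For unitary \<open>e\<close> the relation \<open>u \<sim>\<^sub>h e\<close> says that \<open>e\<^sup>* u\<close> is Hermitian, so determinants are
  preserved up to sign along chains. Conversely, \<open>M = e\<^sup>* u\<close> is a unitary whose real part \<open>M + M\<^sup>*\<close> and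
  imaginary part \<open>- \<i> (M - M\<^sup>*)\<close> are commuting self-adjoint operators leaving the real form
  \<open>{v. e v = cnj v}\<close> invariant; a common orthonormal eigenbasis of that real form gives a unitary \<open>a\<close>
  with \<open>e = a a\<^sup>t\<close> and \<open>u = a D a\<^sup>t\<close>, \<open>D\<close> diagonal. As \<open>x \<mapsto> a x a\<^sup>t\<close> preserves the triple product,
  it remains to join \<open>D\<close> to \<open>1\<close>. Two steps replace diagonal entries \<open>z, z'\<close> by \<open>z z', 1\<close>, so \<open>2 n - 2\<close>
  steps lead to the diagonal matrix with entries \<open>det D, 1, \<dots>, 1\<close>, and one more step removes a sign.\<close>

section \<open>Common eigenbases of commuting self-adjoint operators\<close>

lemma selfadjoint_imp_linear:
  fixes A :: "'a::real_inner \<Rightarrow> 'a"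
  assumes "\<And>x y. A x \<bullet> y = x \<bullet> A y"
  shows "linear A"
proof (rule linearI)
  show "A (x + y) = A x + A y" for x y
  proof -
    have "A (x + y) \<bullet> z = (A x + A y) \<bullet> z" for z
      by (simp add: assms inner_add_left)
    then show ?thesis by (metis vector_eq_rdot)
  qed
  show "A (c *\<^sub>R x) = c *\<^sub>R A x" for c x
  proof -
    have "A (c *\<^sub>R x) \<bullet> z = (c *\<^sub>R A x) \<bullet> z" for z
      by (simp add: assms)
    then show ?thesis by (metis vector_eq_rdot)
  qed
qed

text \<open>A maximiser \<open>v\<close> of the Rayleigh quotient on the unit sphere of
  \<open>S\<close> is an eigenvector: the quadratic form \<open>g\<close> is nonnegative on
  \<open>S\<close> and vanishes at \<open>v\<close>, so its derivative at \<open>v\<close> in the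
  direction \<open>w\<close> must vanish.\<close>

lemma selfadjoint_eigenvector:
  fixes A :: "'a::euclidean_space \<Rightarrow> 'a"
  assumes sa: "\<And>x y. A x \<bullet> y = x \<bullet> A y"
    and S: "subspace S" "S \<noteq> {0}" and inv: "\<And>x. x \<in> S \<Longrightarrow> A x \<in> S"
  obtains v c where "v \<in> S" "v \<noteq> 0" "A v = c *\<^sub>R v"
proof -
  have lin: "linear A" using sa by (rule selfadjoint_imp_linear)
  obtain y where y: "y \<in> S" "y \<noteq> 0" using S subspace_0 by blast
  have "compact (S \<inter> sphere 0 1)"
    by (simp add: S(1) closed_subspace closed_Int_compact)
  moreover have "y /\<^sub>R norm y \<in> S \<inter> sphere 0 1"
    using y S(1) by (simp add: subspace_scale)
  moreover have "continuous_on (S \<inter> sphere 0 1) (\<lambda>x. A x \<bullet> x)"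
    by (intro continuous_on_inner linear_continuous_on continuous_on_id)
      (simp add: lin linear_conv_bounded_linear[symmetric])
  ultimately have "\<exists>v\<in>S \<inter> sphere 0 1. \<forall>x\<in>S \<inter> sphere 0 1. A x \<bullet> x \<le> A v \<bullet> v"
    by (intro continuous_attains_sup) auto
  then obtain v where v: "v \<in> S" "norm v = 1"
    and vmax: "\<And>x. x \<in> S \<Longrightarrow> norm x = 1 \<Longrightarrow> A x \<bullet> x \<le> A v \<bullet> v"
    by (auto simp del: norm_eq_1)
  define c where "c = A v \<bullet> v"
  define g where "g x = c * (x \<bullet> x) - A x \<bullet> x" for x
  have g_nonneg: "0 \<le> g x" if "x \<in> S" for x
  proof (cases "x = 0")
    case False
    let ?y = "x /\<^sub>R norm x"
    have "A ?y \<bullet> ?y \<le> c"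
      unfolding c_def using that False S(1) by (intro vmax) (simp_all add: subspace_scale)
    moreover have "A ?y \<bullet> ?y = (A x \<bullet> x) / (x \<bullet> x)"
      by (simp add: linear_scale[OF lin] dot_square_norm power2_eq_square field_simps)
    ultimately show ?thesis
      using False by (simp add: g_def divide_le_eq)
  qed (simp add: g_def)
  have vv: "v \<bullet> v = 1" using v by (simp add: dot_square_norm)
  \<comment> \<open>\<open>w\<close> is half the gradient of \<open>g\<close> at \<open>v\<close>;
    invariance keeps it in \<open>S\<close>.\<close>
  define w where "w = c *\<^sub>R v - A v"
  have wS: "w \<in> S"
    unfolding w_def using v S(1) inv by (simp add: subspace_diff subspace_scale)
  have expand: "g (v + t *\<^sub>R w) = t * (2 * (w \<bullet> w) + t * g w)" for t
  proof -
    have "A w \<bullet> v = A v \<bullet> w" by (metis sa inner_commute)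
    then have "A (v + t *\<^sub>R w) \<bullet> (v + t *\<^sub>R w) = c + 2 * t * (A v \<bullet> w) + t\<^sup>2 * (A w \<bullet> w)"
      by (simp add: linear_add[OF lin] linear_scale[OF lin] inner_add_left inner_add_right
          c_def power2_eq_square distrib_left)
    moreover have "(v + t *\<^sub>R w) \<bullet> (v + t *\<^sub>R w) = 1 + 2 * t * (v \<bullet> w) + t\<^sup>2 * (w \<bullet> w)"
      by (simp add: inner_add_left inner_add_right vv inner_commute[of w v] power2_eq_square
          distrib_left)
    ultimately have "g (v + t *\<^sub>R w) = 2 * t * (c * (v \<bullet> w) - A v \<bullet> w) + t\<^sup>2 * g w"
      unfolding g_def by (simp only:) (simp add: algebra_simps)
    also have "c * (v \<bullet> w) - A v \<bullet> w = w \<bullet> w"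
      by (subst (3) w_def) (simp add: inner_diff_left)
    finally show ?thesis by (simp add: power2_eq_square algebra_simps)
  qed
  have "w \<bullet> w = 0"
  proof (rule ccontr)
    assume "w \<bullet> w \<noteq> 0"
    then have q: "w \<bullet> w > 0" by (simp add: order_less_le)
    have gw: "g w \<ge> 0" using g_nonneg wS .
    \<comment> \<open>A negative \<open>t\<close> this small keeps
      \<open>2 * (w \<bullet> w) + t * g w\<close> positive, so \<open>g\<close> would be negative
      at \<open>v + t *\<^sub>R w\<close>. The summand 1 covers the case
      \<open>g w = 0\<close>.\<close>
    define t where "t = - (w \<bullet> w) / (1 + g w)"
    have "t < 0" using q gw by (simp add: t_def field_simps)
    have "t * g w \<ge> - (w \<bullet> w)"
      using q gw by (simp add: t_def field_simps)
    then have "t * (2 * (w \<bullet> w) + t * g w) < 0"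
      using q \<open>t < 0\<close> by (intro mult_neg_pos) linarith+
    moreover have "g (v + t *\<^sub>R w) \<ge> 0"
      using g_nonneg v wS S(1) by (simp add: subspace_add subspace_scale)
    ultimately show False using expand by simp
  qed
  then have "A v = c *\<^sub>R v" by (simp add: w_def)
  moreover have "v \<noteq> 0" using v by auto
  ultimately show thesis using that v by blast
qed

text \<open>Induction on \<open>dim S\<close>: as \<open>A\<close> and \<open>B\<close> commute,
  \<open>B\<close> preserves an eigenspace of \<open>A\<close> in \<open>S\<close>, which therefore
  contains a common eigenvector; by self-adjointness the orthogonal complement of that vector in
  \<open>S\<close> is again invariant.\<close>

lemma commuting_selfadjoint_eigenbasis:
  fixes A B :: "'a::euclidean_space \<Rightarrow> 'a"
  assumes saA: "\<And>x y. A x \<bullet> y = x \<bullet> A y" and saB: "\<And>x y. B x \<bullet> y = x \<bullet> B y"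
    and comm: "\<And>x. A (B x) = B (A x)"
    and "subspace S" "\<And>x. x \<in> S \<Longrightarrow> A x \<in> S" "\<And>x. x \<in> S \<Longrightarrow> B x \<in> S"
  shows "\<exists>V\<subseteq>S. pairwise orthogonal V \<and> span V = S \<and>
    (\<forall>x\<in>V. norm x = 1 \<and> (\<exists>c. A x = c *\<^sub>R x) \<and> (\<exists>d. B x = d *\<^sub>R x))"
  using assms(4-)
proof (induction "dim S" arbitrary: S rule: less_induct)
  case less
  note S = less.prems
  show ?case
  proof (cases "S = {0}")
    case True
    then show ?thesis by (intro exI[of _ "{}"]) auto
  next
    case False
    have linA: "linear A" and linB: "linear B"
      using saA saB by (simp_all add: selfadjoint_imp_linear)
    obtain v0 c where v0: "v0 \<in> S" "v0 \<noteq> 0" "A v0 = c *\<^sub>R v0"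
      using selfadjoint_eigenvector[OF saA S(1) False S(2)] by metis
    define E where "E = {x \<in> S. A x = c *\<^sub>R x}"
    have "subspace E"
      unfolding E_def using S(1)
      by (auto simp: subspace_def linear_0[OF linA] linear_add[OF linA] linear_scale[OF linA]
          scaleR_add_right)
    moreover have "E \<noteq> {0}" using v0 by (auto simp: E_def)
    moreover have "B x \<in> E" if "x \<in> E" for x
      using that S(3) comm by (simp add: E_def linear_scale[OF linB])
    ultimately obtain v1 d where v1: "v1 \<in> E" "v1 \<noteq> 0" "B v1 = d *\<^sub>R v1"
      using selfadjoint_eigenvector[OF saB] by metis
    define v where "v = v1 /\<^sub>R norm v1"
    have v: "v \<in> S" "norm v = 1" "A v = c *\<^sub>R v" "B v = d *\<^sub>R v"
      using v1 S(1) by (simp_all add: v_def E_def subspace_scale linear_scale[OF linA]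
          linear_scale[OF linB])
    have vv: "v \<bullet> v = 1" using v by (simp add: dot_square_norm)
    define T where "T = {x \<in> S. v \<bullet> x = 0}"
    have T: "subspace T"
      unfolding T_def using S(1) by (auto simp: subspace_def inner_add_right)
    have "v \<notin> T" using vv by (simp add: T_def)
    moreover have "T \<subseteq> S" by (auto simp: T_def)
    ultimately have "T \<subset> S" using v(1) by blast
    then have "dim T < dim S"
      using T S(1) by (intro dim_psubset) (simp add: span_eq_iff[THEN iffD2])
    moreover have "A x \<in> T" "B x \<in> T" if "x \<in> T" for x
      using that S(2,3) v by (simp_all add: T_def saA[symmetric] saB[symmetric])
    ultimately obtain V where V: "V \<subseteq> T" "pairwise orthogonal V" "span V = T"
      "\<forall>x\<in>V. norm x = 1 \<and> (\<exists>c. A x = c *\<^sub>R x) \<and> (\<exists>d. B x = d *\<^sub>R x)"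
      using less.hyps T by metis
    have "x \<in> span (insert v V)" if "x \<in> S" for x
    proof -
      have "x - (v \<bullet> x) *\<^sub>R v \<in> T"
        using that v vv S(1) by (simp add: T_def subspace_diff subspace_scale inner_diff_right)
      then show ?thesis using V(3) by (auto simp: span_insert)
    qed
    moreover have sub: "insert v V \<subseteq> S" using V(1) v \<open>T \<subset> S\<close> by auto
    ultimately have "span (insert v V) = S"
      using S(1) by (metis span_minimal subsetI subset_antisym)
    moreover have "pairwise orthogonal (insert v V)"
      using V(1,2) by (auto simp: pairwise_insert T_def orthogonal_def inner_commute)
    ultimately show ?thesis using sub V(4) v by (intro exI[of _ "insert v V"]) auto
  qed
qed

section \<open>Complex matrices and vectors\<close>

definition cnj_vec :: "complex^'n \<Rightarrow> complex^'n" where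
  "cnj_vec v = (\<chi> i. cnj (v $ i))"

lemma cnj_vec_nth [simp]: "cnj_vec v $ i = cnj (v $ i)"
  by (simp add: cnj_vec_def)

lemma cnj_vec_cnj_vec [simp]: "cnj_vec (cnj_vec v) = v"
  by (simp add: vec_eq_iff)

lemma cnj_vec_add [simp]: "cnj_vec (v + w) = cnj_vec v + cnj_vec w"
  by (simp add: vec_eq_iff)

lemma cnj_vec_diff [simp]: "cnj_vec (v - w) = cnj_vec v - cnj_vec w"
  by (simp add: vec_eq_iff)

lemma cnj_vec_scale [simp]: "cnj_vec (c *s v) = cnj c *s cnj_vec v"
  by (simp add: vec_eq_iff)

text \<open>For symmetric \<open>X\<close> the entrywise conjugate coincides with the
  adjoint.\<close>

lemma cnj_vec_mult_symmetric:
  assumes "X \<in> sym_mats"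
  shows "cnj_vec (X *v v) = adjoint_mat X *v cnj_vec v"
proof -
  have "X $ i $ j = X $ j $ i" for i j
    using assms unfolding sym_mats_def by (metis (mono_tags) mem_Collect_eq transpose_def vec_lambda_beta)
  then show ?thesis
    by (simp add: vec_eq_iff matrix_vector_mult_def adjoint_mat_def)
qed

lemma adjoint_mat_mult: "adjoint_mat (X ** Y) = adjoint_mat Y ** adjoint_mat X"
  by (simp add: vec_eq_iff adjoint_mat_def matrix_matrix_mult_def mult.commute)

lemma adjoint_mat_adjoint_mat [simp]: "adjoint_mat (adjoint_mat X) = X"
  by (simp add: vec_eq_iff adjoint_mat_def)

lemma det_adjoint_mat: "det (adjoint_mat X) = cnj (det X)"
proof -
  have "det (adjoint_mat X) = det (transpose (adjoint_mat X))"
    by (simp add: det_transpose)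
  also have "\<dots> = cnj (det X)"
    by (simp add: det_def transpose_def adjoint_mat_def)
  finally show ?thesis .
qed

text \<open>The inner product here is the real one, the real part of the Hermitian form. The
  conjugate transpose is the adjoint for it as well, so the real eigenbasis lemma applies.\<close>

lemma inner_adjoint_mat: "(X *v x) \<bullet> y = x \<bullet> (adjoint_mat X *v y)"
proof -
  have "(X *v x) \<bullet> y = (\<Sum>i\<in>UNIV. \<Sum>j\<in>UNIV. (X $ i $ j * x $ j) \<bullet> y $ i)"
    by (simp add: inner_vec_def matrix_vector_mult_def inner_sum_left)
  also have "\<dots> = (\<Sum>i\<in>UNIV. \<Sum>j\<in>UNIV. x $ j \<bullet> (cnj (X $ i $ j) * y $ i))"
    by (simp add: inner_complex_def algebra_simps)
  also have "\<dots> = x \<bullet> (adjoint_mat X *v y)"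
    by (subst sum.swap)
      (simp add: inner_vec_def matrix_vector_mult_def inner_sum_right adjoint_mat_def)
  finally show ?thesis .
qed

lemma inner_cscale: "(c *s x) \<bullet> y = x \<bullet> (cnj c *s (y :: complex^'n))"
  by (simp add: inner_vec_def inner_complex_def algebra_simps)

lemma scaleR_eq_cscale: "r *\<^sub>R v = complex_of_real r *s v"
  by (simp add: vec_eq_iff scaleR_conv_of_real[where 'a = complex])

lemma matrix_mult_cscale: "X *v (c *s v) = c *s (X *v (v :: complex^'n))"
  by (simp add: vec_eq_iff matrix_vector_mult_def sum_distrib_left algebra_simps)

section \<open>Simultaneous diagonalisation of two symmetric unitaries by congruence\<close>

text \<open>The fixed space of the conjugation \<open>v \<mapsto> cnj (e v)\<close>, a real form of the complex vector space.\<close>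

definition real_form :: "complex^'n^'n \<Rightarrow> (complex^'n) set" where
  "real_form e = {v. e *v v = cnj_vec v}"

lemma subspace_real_form: "subspace (real_form e)"
  by (auto simp: subspace_def real_form_def matrix_vector_right_distrib scaleR_eq_cscale
      matrix_mult_cscale) (simp_all add: vec_eq_iff matrix_vector_mult_def)

text \<open>The complex space is the direct sum of the real form and its multiple by the imaginary
  unit, both of the same real dimension.\<close>

lemma dim_real_form:
  fixes e :: "complex^'n^'n"
  assumes "e \<in> sym_mats" "unitary_mat e"
  shows "dim (real_form e) = CARD('n)"
proof -
  let ?R = "real_form e" and ?I = "\<lambda>v::complex^'n. \<i> *s v"
  have lin: "linear ?I"
    by (rule linearI) (simp_all add: vec_eq_iff algebra_simps)
  have "inj ?I"
    by (rule injI) (simp add: vec_eq_iff)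
  then have dimI: "dim (?I ` ?R) = dim ?R"
    using lin by (intro dim_image_eq) (auto intro: inj_on_subset)
  have sub: "subspace (?I ` ?R)"
    using lin subspace_real_form by (rule linear_subspace_image)
  have "?R \<inter> ?I ` ?R = {0}"
  proof -
    \<comment> \<open>Matrices act complex linearly but \<open>cnj_vec\<close> is antilinear, so the
      two memberships disagree in sign.\<close>
    have "v = 0" if "v \<in> ?R" "v = \<i> *s w" "w \<in> ?R" for v w
    proof -
      have "\<i> *s cnj_vec w = - \<i> *s cnj_vec w"
        using that by (simp add: real_form_def matrix_mult_cscale)
      then have "w = 0" by (simp add: vec_eq_iff)
      then show ?thesis using that by simp
    qed
    then show ?thesis
      using subspace_0[OF subspace_real_form] subspace_0[OF sub] by blast
  qed
  moreover have "{x + y |x y. x \<in> ?R \<and> y \<in> ?I ` ?R} = UNIV"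
  proof -
    have "\<exists>x y. v = x + y \<and> x \<in> ?R \<and> y \<in> ?I ` ?R" for v
    proof -
      \<comment> \<open>\<open>J\<close> is the image of \<open>v\<close> under the conjugation
        fixing the real form, an involution because \<open>e\<close> is symmetric and unitary;
        \<open>x\<close> and \<open>y\<close> are the real and imaginary parts of \<open>v\<close>
        with respect to it.\<close>
      define J where "J = cnj_vec (e *v v)"
      have eJ: "e *v J = cnj_vec v"
        using assms by (simp add: J_def cnj_vec_mult_symmetric matrix_vector_mul_assoc unitary_mat_def)
      have ev: "e *v v = cnj_vec J" by (simp add: J_def)
      define x where "x = (1/2) *s (v + J)"
      define y where "y = (- \<i> / 2) *s (v - J)"
      have "x \<in> ?R" "y \<in> ?R"
        by (simp_all add: real_form_def x_def y_def matrix_mult_cscale matrix_vector_right_distrib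
            matrix_vector_mult_diff_distrib eJ ev vec_eq_iff algebra_simps)
      moreover have "v = x + \<i> *s y"
        by (simp add: x_def y_def vec_eq_iff field_simps)
      ultimately show ?thesis by blast
    qed
    then show ?thesis by blast
  qed
  ultimately have "DIM(complex^'n) = 2 * dim ?R"
    using dim_sums_Int[OF subspace_real_form sub, of e] dimI by (simp add: dim_UNIV)
  then show ?thesis by simp
qed

text \<open>Substituting \<open>cnj_vec v = e *v v\<close> turns the Hermitian product into the
  bilinear form of the symmetric matrix \<open>e\<close>, which makes it equal to its own conjugate.
  Hence orthonormal for the real inner product means orthonormal in the Hermitian sense.\<close>

lemma real_form_inner:
  assumes "e \<in> sym_mats" "v \<in> real_form e" "w \<in> real_form e"
  shows "(\<Sum>i\<in>UNIV. cnj (v $ i) * w $ i) = complex_of_real (v \<bullet> w)"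
proof -
  let ?s = "\<Sum>i\<in>UNIV. cnj (v $ i) * w $ i"
  have e: "e $ i $ j = e $ j $ i" for i j
    using assms(1) unfolding sym_mats_def by (metis (mono_tags) mem_Collect_eq transpose_def vec_lambda_beta)
  have ev: "cnj (v $ i) = (\<Sum>j\<in>UNIV. e $ i $ j * v $ j)"
    and ew: "cnj (w $ i) = (\<Sum>j\<in>UNIV. e $ i $ j * w $ j)" for i
    using assms by (simp_all add: real_form_def vec_eq_iff matrix_vector_mult_def)
  have "?s = (\<Sum>i\<in>UNIV. \<Sum>j\<in>UNIV. e $ i $ j * v $ j * w $ i)"
    by (simp add: ev sum_distrib_right)
  also have "\<dots> = (\<Sum>j\<in>UNIV. v $ j * (\<Sum>i\<in>UNIV. e $ j $ i * w $ i))"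
    by (subst sum.swap) (simp add: sum_distrib_left e algebra_simps)
  also have "\<dots> = cnj ?s" by (simp add: ew[symmetric])
  finally have "Im ?s = 0" by (metis Im_complex_of_real Reals_cnj_iff complex_is_Real_iff)
  moreover have "Re ?s = v \<bullet> w"
    by (simp add: inner_vec_def inner_complex_def)
  ultimately show ?thesis by (simp add: complex_eq_iff)
qed

text \<open>One format for diagonal matrices (\<open>\<sigma> = id\<close>) and for the matrices
  with a swap that occur between them in chains.\<close>

definition mono_mat :: "('n \<Rightarrow> 'n) \<Rightarrow> ('n \<Rightarrow> complex) \<Rightarrow> complex^'n^'n" where
  "mono_mat \<sigma> f = (\<chi> k l. if l = \<sigma> k then f k else 0)"

text \<open>Let \<open>W\<close> have the common eigenbasis of the real form as its columns and let
  \<open>a\<close> be its entrywise conjugate. Then \<open>e ** W = a\<close>, and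
  \<open>u ** W\<close> is \<open>a\<close> times a diagonal matrix; since \<open>W\<close> is
  unitary with adjoint \<open>transpose a\<close>, both factorisations follow.\<close>

lemma simultaneous_congruence_diagonalization:
  fixes u e :: "complex^'n^'n"
  assumes u: "u \<in> sym_mats" "unitary_mat u" and e: "e \<in> sym_mats" "unitary_mat e"
  obtains a z where "unitary_mat a" "\<And>k. norm (z k) = 1"
    "e = a ** transpose a" "u = a ** mono_mat id z ** transpose a"
proof -
  define M where "M = adjoint_mat e ** u"
  let ?N = "adjoint_mat M"
  have MN: "M ** ?N = mat 1" "?N ** M = mat 1"
    using u(2) e(2) unfolding M_def unitary_mat_def adjoint_mat_mult adjoint_mat_adjoint_mat
    by (metis matrix_mul_assoc matrix_mul_rid)+
  define A where "A v = M *v v + ?N *v v" for v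
  define B where "B v = (- \<i>) *s (M *v v - ?N *v v)" for v
  have saA: "A x \<bullet> y = x \<bullet> A y" for x y
    by (simp add: A_def inner_add_left inner_add_right inner_adjoint_mat)
  have saB: "B x \<bullet> y = x \<bullet> B y" for x y
    by (simp add: B_def inner_cscale inner_diff_left inner_diff_right inner_adjoint_mat
        matrix_mult_cscale)
  have comm: "A (B x) = B (A x)" for x
    by (simp add: A_def B_def matrix_mult_cscale matrix_vector_right_distrib
        matrix_vector_mult_diff_distrib matrix_vector_mul_assoc MN algebra_simps)
  \<comment> \<open>Together these say that on the real form \<open>e\<close> sends
    \<open>M v\<close> to the conjugate of \<open>?N v\<close> and vice versa, whence
    \<open>A\<close> and \<open>B\<close> preserve the real form.\<close>
  have eM: "e *v (M *v v) = u *v v" and eN: "e *v (?N *v v) = cnj_vec (M *v v)"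
    and cN: "cnj_vec (?N *v v) = u *v v"
    if "v \<in> real_form e" for v
  proof -
    have ev: "e *v v = cnj_vec v" using that by (simp add: real_form_def)
    have ev': "adjoint_mat e *v cnj_vec v = v"
      using e(2) by (simp add: ev[symmetric] matrix_vector_mul_assoc unitary_mat_def)
    show "e *v (M *v v) = u *v v"
      using e(2) unfolding M_def unitary_mat_def
      by (metis matrix_mul_assoc matrix_mul_lid matrix_vector_mul_assoc)
    have N: "?N *v v = adjoint_mat u *v cnj_vec v"
      by (simp add: M_def adjoint_mat_mult ev[symmetric] matrix_vector_mul_assoc)
    have "cnj_vec (u *v v) = adjoint_mat u *v cnj_vec v"
      using u(1) by (rule cnj_vec_mult_symmetric)
    with N show "cnj_vec (?N *v v) = u *v v" by (metis cnj_vec_cnj_vec)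
    have "cnj_vec (e *v (?N *v v)) = adjoint_mat e *v (u *v v)"
      using cnj_vec_mult_symmetric[OF e(1)] N \<open>cnj_vec (u *v v) = _\<close> by (metis cnj_vec_cnj_vec)
    then show "e *v (?N *v v) = cnj_vec (M *v v)"
      by (metis M_def cnj_vec_cnj_vec matrix_vector_mul_assoc)
  qed
  have "A v \<in> real_form e" "B v \<in> real_form e" if "v \<in> real_form e" for v
    by (simp_all add: A_def B_def real_form_def matrix_mult_cscale matrix_vector_right_distrib
        matrix_vector_mult_diff_distrib eM[OF that] eN[OF that] cN[OF that] algebra_simps)
  then obtain V where V: "V \<subseteq> real_form e" "pairwise orthogonal V" "span V = real_form e"
    "\<forall>x\<in>V. norm x = 1 \<and> (\<exists>c. A x = c *\<^sub>R x) \<and> (\<exists>d. B x = d *\<^sub>R x)"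
    using commuting_selfadjoint_eigenbasis[OF saA saB comm subspace_real_form] by metis
  have "independent V"
    using V(2,4) by (intro pairwise_orthogonal_independent) auto
  then have "card V = CARD('n)" and "finite V"
    using V(3) dim_real_form[OF e] dim_span[of V] dim_eq_card_independent[of V]
      independent_bound[of V] by auto
  \<comment> \<open>The basis has as many vectors as \<open>'n\<close> has elements, so it can be
    indexed by \<open>'n\<close> and serve as the columns of a square matrix.\<close>
  then obtain b where b: "bij_betw b (UNIV :: 'n set) V"
    by (metis finite_class.finite_UNIV finite_same_card_bij)
  then have bV: "b k \<in> V" for k by (auto simp: bij_betw_def)
  then have bR: "b k \<in> real_form e" for k using V(1) by auto
  have ip: "b k \<bullet> b l = (if k = l then 1 else 0)" for k l
  proof (cases "k = l")
    case True
    then show ?thesis using V(4) bV by (simp add: dot_square_norm)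
  next
    case False
    then have "b k \<noteq> b l" using b by (metis UNIV_I bij_betw_def inj_onD)
    then show ?thesis using False V(2) bV by (auto simp: pairwise_def orthogonal_def)
  qed
  have "\<exists>z. u *v b k = z *s cnj_vec (b k)" for k
  proof -
    obtain c d where "A (b k) = c *\<^sub>R b k" "B (b k) = d *\<^sub>R b k" using V(4) bV by blast
    \<comment> \<open>Recombining real and imaginary parts: a common eigenvector of \<open>A\<close>
      and \<open>B\<close> is an eigenvector of \<open>M\<close>, with a complex eigenvalue.\<close>
    moreover have "M *v b k = (1/2) *s (A (b k) + \<i> *s B (b k))"
      by (simp add: A_def B_def vec_eq_iff algebra_simps)
    ultimately have "M *v b k = ((c + \<i> * d) / 2) *s b k"
      by (simp add: scaleR_eq_cscale vec_eq_iff algebra_simps add_divide_distrib)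
    then have "u *v b k = ((c + \<i> * d) / 2) *s (e *v b k)"
      using eM[OF bR] by (metis matrix_mult_cscale)
    then show ?thesis using bR[of k] unfolding real_form_def mem_Collect_eq by metis
  qed
  then obtain z where z: "\<And>k. u *v b k = z k *s cnj_vec (b k)" by metis
  define W where "W = (\<chi> j k. b k $ j)"
  define a where "a = adjoint_mat (transpose W)"
  have ta: "transpose a = adjoint_mat W"
    by (simp add: a_def adjoint_mat_def transpose_def vec_eq_iff)
  have "adjoint_mat W ** W = mat 1"
    using real_form_inner[OF e(1) bR bR]
    by (simp add: vec_eq_iff matrix_matrix_mult_def adjoint_mat_def W_def mat_def ip)
  then have W: "adjoint_mat W ** W = mat 1" "W ** adjoint_mat W = mat 1"
    by (simp_all add: matrix_left_right_inverse)
  have "unitary_mat a"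
  proof -
    have "adjoint_mat a = transpose W" by (simp add: a_def)
    moreover have "a = transpose (adjoint_mat W)" using ta by (metis transpose_transpose)
    ultimately show ?thesis
      using W by (simp add: unitary_mat_def matrix_transpose_mul[symmetric] transpose_mat)
  qed
  have "e ** W = a"
  proof -
    have "(e ** W) $ i $ k = (e *v b k) $ i" for i k
      by (simp add: matrix_matrix_mult_def matrix_vector_mult_def W_def)
    then show ?thesis
      using bR by (simp add: vec_eq_iff real_form_def a_def adjoint_mat_def transpose_def W_def)
  qed
  have "u ** W = a ** mono_mat id z"
  proof -
    have "(u ** W) $ i $ k = (u *v b k) $ i" for i k
      by (simp add: matrix_matrix_mult_def matrix_vector_mult_def W_def)
    moreover have "(a ** mono_mat id z) $ i $ k = cnj (b k $ i) * z k" for i k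
      by (simp add: matrix_matrix_mult_def mono_mat_def a_def adjoint_mat_def transpose_def W_def
          if_distrib cong: if_cong)
    ultimately show ?thesis by (simp add: vec_eq_iff z mult.commute)
  qed
  have "norm (z k) = 1" for k
  proof -
    have "(u *v b k) \<bullet> (u *v b k) = b k \<bullet> b k"
      using u(2) by (simp add: inner_adjoint_mat matrix_vector_mul_assoc unitary_mat_def)
    moreover have "(u *v b k) \<bullet> (u *v b k) = (norm (z k))\<^sup>2 * (b k \<bullet> b k)"
      unfolding z by (simp add: inner_vec_def inner_complex_def cmod_power2 sum_distrib_left)
        (simp add: power2_eq_square algebra_simps)
    ultimately have "(norm (z k))\<^sup>2 = 1\<^sup>2" using ip[of k k] by simp
    then show ?thesis by (simp only: power2_eq_iff_nonneg norm_ge_zero zero_le_one)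
  qed
  moreover have "e = a ** transpose a"
    using \<open>e ** W = a\<close> W(2) by (metis ta matrix_mul_assoc matrix_mul_rid)
  moreover have "u = a ** mono_mat id z ** transpose a"
    using \<open>u ** W = _\<close> W(2) by (metis ta matrix_mul_assoc matrix_mul_rid)
  ultimately show thesis using that \<open>unitary_mat a\<close> by blast
qed

section \<open>Chains\<close>

lemma triple_same_outer: "triple a b a = a ** adjoint_mat b ** a"
  by (simp add: triple_def scaleR_2[symmetric])

section \<open>Monomial matrices\<close>

lemma mono_mat_mult: "mono_mat \<sigma> f ** mono_mat \<tau> g = mono_mat (\<tau> \<circ> \<sigma>) (\<lambda>k. f k * g (\<sigma> k))"
  by (simp add: mono_mat_def matrix_matrix_mult_def vec_eq_iff if_distrib[of "\<lambda>x. x * _"]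
      cong: if_cong)

lemma adjoint_mono_mat:
  assumes "\<And>k. \<sigma> (\<sigma> k) = k"
  shows "adjoint_mat (mono_mat \<sigma> f) = mono_mat \<sigma> (\<lambda>k. cnj (f (\<sigma> k)))"
  using assms by (auto simp: mono_mat_def adjoint_mat_def vec_eq_iff)

lemma mult_cnj_norm1: "norm (z::complex) = 1 \<Longrightarrow> z * cnj z = 1"
  by (simp add: complex_norm_square[symmetric])

text \<open>Symmetry comes from \<open>\<sigma>\<close> being an involution with \<open>w\<close>
  constant on its orbits, the tripotent law from entries of modulus one.\<close>

lemma sym_tripotent_mono_mat:
  assumes "\<And>k. \<sigma> (\<sigma> k) = k" "\<And>k. w (\<sigma> k) = w k" "\<And>k. norm (w k) = 1"
  shows "sym_tripotent (mono_mat \<sigma> w)"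
proof -
  have "transpose (mono_mat \<sigma> w) = mono_mat \<sigma> w"
    using assms by (auto simp: mono_mat_def transpose_def vec_eq_iff)
  moreover have "triple (mono_mat \<sigma> w) (mono_mat \<sigma> w) (mono_mat \<sigma> w) = mono_mat \<sigma> w"
    using assms mult_cnj_norm1
    by (simp add: triple_same_outer adjoint_mono_mat mono_mat_mult comp_def)
  ultimately show ?thesis by (simp add: sym_tripotent_def sym_mats_def)
qed

text \<open>Both triple products are again monomial, and for entries of modulus one both equations
  reduce entrywise to \<open>sq\<close>.\<close>

lemma sim_h_mono_mat:
  assumes "\<And>k. \<sigma> (\<sigma> k) = k" "\<And>k. w (\<sigma> k) = w k" "\<And>k. norm (w k) = 1" "\<And>k. norm (z k) = 1"
    and sq: "\<And>k. w k * w k = z k * z (\<sigma> k)"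
  shows "sim_h (mono_mat id z) (mono_mat \<sigma> w)"
proof -
  have 1: "w k * cnj (z (\<sigma> k)) * w k = z k" for k
  proof -
    have "w k * cnj (z (\<sigma> k)) * w k = z k * (z (\<sigma> k) * cnj (z (\<sigma> k)))"
      using sq[of k] by (metis mult.assoc mult.commute)
    then show ?thesis using mult_cnj_norm1 assms(4) by simp
  qed
  have 2: "z k * cnj (w k) * z (\<sigma> k) = w k" for k
  proof -
    have "z k * cnj (w k) * z (\<sigma> k) = w k * (w k * cnj (w k))"
      using sq[of k] by (metis mult.assoc mult.commute)
    then show ?thesis using mult_cnj_norm1 assms(3) by simp
  qed
  show ?thesis
    using assms(1,2) 1 2
    by (simp add: sim_h_def le_h_def triple_same_outer adjoint_mono_mat mono_mat_mult comp_def id_def)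
qed

section \<open>Construction of chains between diagonal matrices\<close>

lemma sim_h_sym: "sim_h u e \<Longrightarrow> sim_h e u"
  by (simp add: sim_h_def)

lemma sim_h_chain_0: "sym_tripotent u \<Longrightarrow> sim_h_chain 0 u u"
  by (auto simp: sim_h_chain_def)

lemma sim_h_chain_Suc:
  assumes "sim_h_chain k u v" "sim_h v e" "sym_tripotent e"
  shows "sim_h_chain (Suc k) u e"
proof -
  obtain w where w: "w 0 = u" "w k = v" "\<forall>j\<le>k. sym_tripotent (w j)"
    "\<forall>j<k. sim_h (w j) (w (Suc j))"
    using assms(1) by (auto simp: sim_h_chain_def)
  then show ?thesis
    unfolding sim_h_chain_def using assms(2,3)
    by (intro exI[of _ "w(Suc k := e)"]) (auto simp: less_Suc_eq le_Suc_eq)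
qed

text \<open>On the indices \<open>i\<close>, \<open>j\<close> the intermediate matrix is \<open>c\<close> times the swap, where \<open>c\<^sup>2 = z i * z j\<close>;
  this depends on the product of the two diagonal entries only.\<close>

lemma sim_h_chain_merge:
  assumes "sim_h_chain m p (mono_mat id z)" "\<And>k. norm (z k) = 1" "i \<noteq> j"
  shows "sim_h_chain (m + 2) p (mono_mat id (z(i := z i * z j, j := 1)))"
proof -
  define c where "c = csqrt (z i * z j)"
  define \<sigma> where "\<sigma> k = (if k = i then j else if k = j then i else k)" for k
  define w where "w k = (if k = i \<or> k = j then c else z k)" for k
  let ?z = "z(i := z i * z j, j := 1)"
  have cc: "c * c = z i * z j" by (simp add: c_def power2_eq_square[symmetric])
  have "norm c * norm c = 1" by (simp add: norm_mult[symmetric] cc) (simp add: norm_mult assms)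
  then have c: "norm c = 1"
    by (metis abs_norm_cancel power2_eq_1_iff power2_eq_square abs_1 abs_minus_cancel)
  have \<sigma>: "\<sigma> (\<sigma> k) = k" "w (\<sigma> k) = w k" "norm (w k) = 1" "norm (?z k) = 1" for k
    using assms c by (auto simp: \<sigma>_def w_def norm_mult)
  have "sim_h (mono_mat id z) (mono_mat \<sigma> w)"
    by (rule sim_h_mono_mat) (use \<sigma> assms cc in \<open>auto simp: w_def \<sigma>_def\<close>)
  moreover have "sim_h (mono_mat \<sigma> w) (mono_mat id ?z)"
    by (rule sim_h_sym, rule sim_h_mono_mat) (use \<sigma> assms cc in \<open>auto simp: w_def \<sigma>_def\<close>)
  moreover have "sym_tripotent (mono_mat \<sigma> w)"
    using \<sigma> by (intro sym_tripotent_mono_mat)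
  moreover have "sym_tripotent (mono_mat id ?z)"
    by (rule sym_tripotent_mono_mat) (simp_all only: id_apply \<sigma>)
  ultimately have "sim_h_chain (Suc (Suc m)) p (mono_mat id ?z)"
    using assms(1) by (blast intro: sim_h_chain_Suc)
  then show ?thesis by simp
qed

text \<open>The other entries are merged into position \<open>i\<close> one at a time, each at the
  cost of two steps.\<close>

lemma sim_h_chain_diagonal:
  fixes z :: "'n::finite \<Rightarrow> complex"
  assumes "\<And>k. norm (z k) = 1"
  shows "sim_h_chain (2 * (CARD('n) - 1)) (mono_mat id z)
    (mono_mat id ((\<lambda>_. 1)(i := \<Prod>k\<in>UNIV. z k)))"
proof -
  \<comment> \<open>\<open>F\<close> is the set of indices already merged into \<open>i\<close>; the
    full complement of \<open>i\<close> is taken at the end.\<close>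
  have "sim_h_chain (2 * card F) (mono_mat id z)
    (mono_mat id (\<lambda>k. if k = i then z i * prod z F else if k \<in> F then 1 else z k))"
    if "i \<notin> F" for F
    using finite[of F] that
  proof (induction F rule: finite_induct)
    case empty
    have "(\<lambda>k. if k = i then z i else z k) = z" by auto
    moreover have "sym_tripotent (mono_mat id z)"
      using assms by (intro sym_tripotent_mono_mat) auto
    ultimately show ?case
      by (simp add: sim_h_chain_0 id_def cong: if_cong)
  next
    case (insert j F)
    let ?y = "\<lambda>k. if k = i then z i * prod z F else if k \<in> F then 1 else z k"
    have "norm (?y k) = 1" for k
      using assms by (simp add: norm_mult prod_norm[symmetric])
    then have "sim_h_chain (2 * card F + 2) (mono_mat id z)
        (mono_mat id (?y(i := ?y i * ?y j, j := 1)))"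
      using insert by (intro sim_h_chain_merge) (auto simp: id_def)
    moreover have "?y(i := ?y i * ?y j, j := 1) =
      (\<lambda>k. if k = i then z i * prod z (insert j F) else if k \<in> insert j F then 1 else z k)"
      using insert by (auto simp: fun_eq_iff)
    ultimately show ?case using insert by (simp add: id_def)
  qed
  from this[of "UNIV - {i}"] have "sim_h_chain (2 * (CARD('n) - 1)) (mono_mat id z)
    (mono_mat id (\<lambda>k. if k = i then z i * prod z (UNIV - {i})
      else if k \<in> UNIV - {i} then 1 else z k))"
    by (simp add: card_Diff_singleton)
  moreover have "(\<lambda>k. if k = i then z i * prod z (UNIV - {i})
      else if k \<in> UNIV - {i} then 1 else z k) = (\<lambda>_. 1)(i := \<Prod>k\<in>UNIV. z k)"
    by (auto simp: fun_eq_iff prod.remove[of UNIV i])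
  ultimately show ?thesis by simp
qed

section \<open>Transport of chains by unitary congruence\<close>

lemma triple_congruence:
  assumes "unitary_mat a"
  shows "triple (a ** x ** transpose a) (a ** y ** transpose a) (a ** x ** transpose a)
    = a ** triple x y x ** transpose a"
proof -
  have 1: "adjoint_mat a ** a = mat 1" using assms by (simp add: unitary_mat_def)
  have "transpose a ** adjoint_mat (transpose a) = transpose (adjoint_mat a ** a)"
    by (simp add: matrix_transpose_mul) (simp add: transpose_def adjoint_mat_def)
  then have 2: "transpose a ** adjoint_mat (transpose a) = mat 1"
    by (simp add: 1 transpose_mat)
  have "(a ** x ** transpose a) ** adjoint_mat (a ** y ** transpose a) ** (a ** x ** transpose a)
    = a ** x ** (transpose a ** adjoint_mat (transpose a)) ** adjoint_mat y **
      (adjoint_mat a ** a) ** x ** transpose a"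
    by (simp add: adjoint_mat_mult matrix_mul_assoc)
  then show ?thesis by (simp add: 1 2 triple_same_outer matrix_mul_assoc)
qed

text \<open>The right factor is \<open>transpose a\<close> so that symmetric matrices stay
  symmetric; the triple product is respected because \<open>a\<close> is unitary.\<close>

lemma sim_h_chain_congruence:
  assumes "unitary_mat a" "sim_h_chain k x y"
  shows "sim_h_chain k (a ** x ** transpose a) (a ** y ** transpose a)"
proof -
  obtain w where w: "w 0 = x" "w k = y" "\<forall>j\<le>k. sym_tripotent (w j)"
    "\<forall>j<k. sim_h (w j) (w (Suc j))"
    using assms(2) by (auto simp: sim_h_chain_def)
  let ?\<Phi> = "\<lambda>x. a ** x ** transpose a"
  have "sym_tripotent (?\<Phi> p)" if "sym_tripotent p" for p
    using that
    by (simp add: sym_tripotent_def triple_congruence[OF assms(1)] sym_mats_def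
        matrix_transpose_mul matrix_mul_assoc)
  moreover have "sim_h (?\<Phi> p) (?\<Phi> q)" if "sim_h p q" for p q
    using that unfolding sim_h_def le_h_def by (metis triple_congruence[OF assms(1)])
  ultimately show ?thesis
    unfolding sim_h_chain_def using w by (intro exI[of _ "?\<Phi> \<circ> w"]) auto
qed

text \<open>A sequence for \<open>le_ht x y\<close> starts at \<open>y\<close> and ends at
  \<open>x\<close>. Hence \<open>w\<close> itself witnesses \<open>le_ht e u\<close>, and the
  reversed sequence witnesses \<open>le_ht u e\<close>.\<close>

lemma sim_h_chain_imp_sim_ht:
  assumes "sim_h_chain k u e"
  shows "sim_ht u e"
proof -
  obtain w where w: "w 0 = u" "w k = e" "\<forall>j\<le>k. sym_tripotent (w j)"
    "\<And>j. j < k \<Longrightarrow> sim_h (w j) (w (Suc j))"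
    using assms by (auto simp: sim_h_chain_def)
  have "le_h (w j) (w (j - 1))" if "j \<in> {1..k}" for j
    using w(4)[of "j - 1"] that by (cases j) (auto simp: sim_h_def)
  then have "le_ht e u"
    unfolding le_ht_def using w by (intro exI[of _ k] exI[of _ w]) auto
  moreover have "le_h (w (k - j)) (w (k - (j - 1)))" if "j \<in> {1..k}" for j
    using w(4)[of "k - j"] that by (simp add: sim_h_def Suc_diff_le)
  then have "le_ht u e"
    unfolding le_ht_def using w by (intro exI[of _ k] exI[of _ "\<lambda>j. w (k - j)"]) auto
  ultimately show ?thesis by (simp add: sim_ht_def)
qed

section \<open>Determinants along chains\<close>

text \<open>Determinants in \<open>u = triple e u e\<close> give
  \<open>det u = (det e)\<^sup>2 * cnj (det u)\<close>. An invertible tripotent has determinant of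
  modulus one, so multiplying by \<open>det u\<close> compares the squares.\<close>

lemma le_h_det:
  assumes "le_h u e" "det u \<noteq> 0"
  shows "det e \<noteq> 0" "sym_tripotent u \<Longrightarrow> (det u)\<^sup>2 = (det e)\<^sup>2"
proof -
  have u: "det u = (det e)\<^sup>2 * cnj (det u)"
    using arg_cong[OF assms(1)[unfolded le_h_def triple_same_outer], of det]
    by (simp add: det_mul det_adjoint_mat power2_eq_square algebra_simps)
  then show "det e \<noteq> 0" using assms(2) by auto
  assume "sym_tripotent u"
  then have "triple u u u = u" by (simp add: sym_tripotent_def)
  from arg_cong[OF this, of det] have "det u * cnj (det u) = 1"
    using assms(2) by (simp add: triple_same_outer det_mul det_adjoint_mat)
  then show "(det u)\<^sup>2 = (det e)\<^sup>2"
    using u by (metis mult.assoc mult.commute mult.right_neutral power2_eq_square)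
qed

text \<open>The intermediate tripotents are not assumed invertible. A nonzero determinant passes
  from the smaller element to the larger, so the induction runs backwards from \<open>u\<close> at
  the end of the sequence to \<open>e\<close>.\<close>

lemma le_ht_det:
  assumes "le_ht u e" "det u \<noteq> 0"
  shows "det u = det e \<or> det u = - det e"
proof -
  obtain k :: nat and v where v: "v 0 = e" "v k = u" "\<forall>j\<le>k. sym_tripotent (v j)"
    "\<forall>j\<in>{1..k}. le_h (v j) (v (j - 1))"
    using assms(1) unfolding le_ht_def by blast
  have "det (v (k - i)) \<noteq> 0 \<and> (det (v (k - i)))\<^sup>2 = (det u)\<^sup>2" if "i \<le> k" for i
    using that
  proof (induction i)
    case 0
    then show ?case using v assms by simp
  next
    case (Suc i)
    have "le_h (v (k - i)) (v (k - i - 1))" using bspec[OF v(4), of "k - i"] Suc.prems by simp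
    then have "le_h (v (k - i)) (v (k - Suc i))" by simp
    then show ?case using le_h_det Suc v(3) by (metis Suc_leD diff_le_self)
  qed
  from this[of k] show ?thesis using v(1) by (auto simp: power2_eq_iff)
qed

theorem proposition5p7:
  fixes u e :: "complex^'n^'n"
  assumes "u \<in> sym_mats" and "unitary_mat u"
    and "e \<in> sym_mats" and "unitary_mat e"
  shows "(sim_ht u e \<longleftrightarrow> det u = det e \<or> det u = - det e) \<and>
    (sim_ht u e \<longrightarrow>
      (\<exists>k \<le> 2 * CARD('n) - 1. sim_h_chain k u e) \<and>
      (det u = det e \<longrightarrow> (\<exists>k \<le> 2 * CARD('n) - 2. sim_h_chain k u e)))"
proof -
  obtain a z where a: "unitary_mat a" and z: "\<And>k. norm (z k) = 1"
    and e: "e = a ** transpose a" and u: "u = a ** mono_mat id z ** transpose a"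
    using simultaneous_congruence_diagonalization assms by metis
  have unit_det: "det x \<noteq> 0" if "unitary_mat x" for x :: "complex^'n^'n"
    using that unfolding unitary_mat_def by (metis invertible_def invertible_det_nz)
  define P where "P = (\<Prod>k\<in>UNIV. z k)"
  have "det (mono_mat id z) = P"
    unfolding P_def by (subst det_diagonal) (simp_all add: mono_mat_def)
  then have det_u: "det u = det e * P"
    by (simp add: u e det_mul)
  \<comment> \<open>An arbitrary index, at which the product \<open>P\<close> of all diagonal
    entries is collected.\<close>
  fix i :: 'n
  define d where "d = (\<lambda>_. 1::complex)(i := P)"
  have one: "mono_mat id (\<lambda>_. 1) = (mat 1 :: complex^'n^'n)"
    by (simp add: mono_mat_def mat_def vec_eq_iff)
  have chain: "sim_h_chain (2 * (CARD('n) - 1)) (mono_mat id z) (mono_mat id d)"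
    using sim_h_chain_diagonal[of z i] z by (simp add: d_def P_def)
  have transfer: "sim_h_chain k u e" if "sim_h_chain k (mono_mat id z) (mono_mat id (\<lambda>_. 1))" for k
    using sim_h_chain_congruence[OF a that] by (simp add: e u one)
  have eq: "sim_h_chain (2 * CARD('n) - 2) u e" if "det u = det e"
  proof -
    have "P = 1" using that det_u unit_det[OF assms(4)] by simp
    then have "d = (\<lambda>_. 1)" by (auto simp: d_def)
    then show ?thesis using chain transfer by (simp add: diff_mult_distrib2)
  qed
  have neg: "sim_h_chain (2 * CARD('n) - 1) u e" if "det u = - det e"
  proof -
    have "P = -1"
      using that det_u unit_det[OF assms(4)] by (metis mult_cancel_left mult_minus1_right)
    \<comment> \<open>With \<open>\<sigma> = id\<close> the condition on the entries says that
      squares agree, so the sign at \<open>i\<close> disappears in a single step.\<close>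
    then have "sim_h (mono_mat id d) (mono_mat id (\<lambda>_. 1))"
      by (intro sim_h_mono_mat) (auto simp: d_def)
    then have "sim_h_chain (Suc (2 * (CARD('n) - 1))) u e"
      using chain by (intro transfer sim_h_chain_Suc sym_tripotent_mono_mat) auto
    \<comment> \<open>Subtraction on naturals is truncated, so this uses that
      \<open>CARD('n)\<close> is positive.\<close>
    moreover have "Suc (2 * (CARD('n) - 1)) = 2 * CARD('n) - 1"
      using zero_less_card_finite[where 'a='n] by linarith
    ultimately show ?thesis by simp
  qed
  have "sim_ht u e \<longleftrightarrow> det u = det e \<or> det u = - det e"
    using eq neg sim_h_chain_imp_sim_ht le_ht_det[OF _ unit_det[OF assms(2)]]
    by (auto simp: sim_ht_def)
  moreover have "2 * CARD('n) - 2 \<le> 2 * CARD('n) - 1" by linarith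
  ultimately show ?thesis using eq neg by blast
qed

end
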